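(* Consider the parameterized system $\frac{d}{dt}\mathbf{x}=\mathbf{f}(\mathbf{x},\boldsymbol{\alpha})$, $\mathbf{x}(0)=\mathbf{x}_0$, with state variables $\mathbf{x}\in I_{\mathbf{x}}\subseteq\mathbb{R}^d$, parameters $\boldsymbol{\alpha}\in I_{\boldsymbol{\alpha}}\subseteq\mathbb{R}^\ell$ with probability density $\rho_{\boldsymbol{\alpha}}$ on $I_{\boldsymbol{\alpha}}$, and $\mathbf{f}:\mathbb{R}^d\times\mathbb{R}^\ell\to\mathbb{R}^d$. Let $I_\Delta\subset[0,\infty)$ be a compact interval (the range of time lags) with right endpoint $\Delta>0$, let $n\ge1$, $\delta_0,\dots,\delta_{n-1}\in I_\Delta$ and $t=\sum_{i=0}^{n-1}\delta_i$. Suppose $\mathbf{f}(\mathbf{x},\boldsymbol{\alpha})$ is Lipschitz continuous with respect to $\mathbf{x}$ with a uniform Lipschitz constant $L>0$ for all $\boldsymbol{\alpha}\in I_{\boldsymbol{\alpha}}$. Let $\boldsymbol{\Psi}$ be the effective increment of the system (defined in the context), and suppose that the trained neural network $\widehat{\mathbf{N}}:\mathbb{R}^{d+\ell+1}\to\mathbb{R}^d$ satisfies, for a given $\mathcal{E}>0$, $$\left|\widehat{\mathbf{N}}(\mathbf{z},\boldsymbol{\alpha},\delta)-\boldsymbol{\Psi}(\mathbf{z},\boldsymbol{\alpha},\delta)\right|\le\mathcal{E}\qquad\text{for all }(\mathbf{z},\boldsymbol{\alpha},\delta)\in I_{\mathbf{x}}\times I_{\boldsymbol{\alpha}}\times I_\Delta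 .$$ For a fixed initial condition $\mathbf{x}_0\in I_{\mathbf{x}}$, let $\mathbf{x}(t;\boldsymbol{\alpha})$ and $\widehat{\mathbf{x}}(t;\boldsymbol{\alpha})$ be the exact solution and the network prediction at time $t$ (defined in the context), and assume that the solution is bounded: $\|\mathbf{x}(t;\cdot)\|_{L^\infty(I_{\boldsymbol{\alpha}})}=C_t<\infty$. Then $$\left|\mathbb{E}_{\boldsymbol{\alpha}}[\mathbf{x}(t;\boldsymbol{\alpha})]-\mathbb{E}_{\boldsymbol{\alpha}}[\widehat{\mathbf{x}}(t;\boldsymbol{\alpha})]\right|\le C(n,L,\Delta)\,\mathcal{E},$$ $$\left|\mathrm{Var}_{\boldsymbol{\alpha}}[\mathbf{x}(t;\boldsymbol{\alpha})]-\mathrm{Var}_{\boldsymbol{\alpha}}[\widehat{\mathbf{x}}(t;\boldsymbol{\alpha})]\right|\le 2\,C(n,L,\Delta)^2\,\mathcal{E}^2+4\,C(n,L,\Delta)\,C_t\,\mathcal{E},$$ where $C(n,L,\Delta)=\frac{e^{nL\Delta}-1}{e^{L\Delta}-1}$.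
   Context: $|\cdot|$ is the Euclidean norm on $\mathbb{R}^d$, and $\|\mathbf{g}\|_{L^\infty}$ is the $L^\infty$ norm of $|\mathbf{g}|$. Exact solution: $\mathbf{x}(\cdot;\boldsymbol{\alpha},\mathbf{x}_0)$ is the solution of $\frac{d}{dt}\mathbf{x}=\mathbf{f}(\mathbf{x},\boldsymbol{\alpha})$, $\mathbf{x}(0)=\mathbf{x}_0$; for fixed $\mathbf{x}_0$ it is written $\mathbf{x}(t;\boldsymbol{\alpha})$. Flow map: $\boldsymbol{\Phi}_s(\mathbf{z},\boldsymbol{\alpha})=\mathbf{x}(s;\boldsymbol{\alpha},\mathbf{z})$. Effective increment: $\boldsymbol{\Psi}(\mathbf{z},\boldsymbol{\alpha},\delta)=\int_0^\delta\mathbf{f}(\boldsymbol{\Phi}_s(\mathbf{z},\boldsymbol{\alpha}),\boldsymbol{\alpha})\,ds$, so that $\boldsymbol{\Phi}_\delta(\mathbf{z},\boldsymbol{\alpha})=\mathbf{z}+\boldsymbol{\Psi}(\mathbf{z},\boldsymbol{\alpha},\delta)$. Neural network: $\widehat{\mathbf{N}}$ is the operator of a feedforward network, i.e. an alternating composition of affine maps and activation functions applied componentwise, with its parameters fixed after training. Network prediction: put $t_0=0$, $t_{k+1}=t_k+\delta_k$, $\widehat{\mathbf{x}}(t_0;\boldsymbol{\alpha})=\mathbf{x}_0$ and $\widehat{\mathbf{x}}(t_{k+1};\boldsymbol{\alpha})=\widehat{\mathbf{x}}(t_k;\boldsymbol{\alpha})+\widehat{\mathbf{N}}(\widehat{\mathbf{x}}(t_k;\boldsymbol{\alpha}),\boldsymbol{\alpha},\delta_k)$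 for $k=0,\dots,n-1$. Then $t=t_n$, and $\widehat{\mathbf{x}}(t;\boldsymbol{\alpha})$ means $\widehat{\mathbf{x}}(t_n;\boldsymbol{\alpha})$. Statistics: for $\mathbf{g}:I_{\boldsymbol{\alpha}}\to\mathbb{R}^d$ (measurability being understood), $\mathbb{E}_{\boldsymbol{\alpha}}[\mathbf{g}]=\int_{I_{\boldsymbol{\alpha}}}\mathbf{g}(\mathbf{y})\rho_{\boldsymbol{\alpha}}(\mathbf{y})\,d\mathbf{y}$ and $\mathrm{Var}_{\boldsymbol{\alpha}}[\mathbf{g}]=\int_{I_{\boldsymbol{\alpha}}}\left(\mathbf{g}(\mathbf{y})-\mathbb{E}_{\boldsymbol{\alpha}}[\mathbf{g}]\right)^2\rho_{\boldsymbol{\alpha}}(\mathbf{y})\,d\mathbf{y}$, squares of vectors being taken componentwise.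
   Formalization: The formal theorem additionally assumes that the network predictions at the steps t_0,…,t_{n-1} lie in I_x for every α in I_α; without this the claim fails, since the error bound on the network is given only for states in I_x. *)

theory Defs
  imports "HOL-Analysis.Analysis" "HOL-Probability.Essential_Supremum"
begin

definition solves_ivp ::
  "('a::euclidean_space \<Rightarrow> 'p \<Rightarrow> 'a) \<Rightarrow> 'p \<Rightarrow> 'a \<Rightarrow> (real \<Rightarrow> 'a) \<Rightarrow> bool" where
  "solves_ivp f \<alpha> z x \<longleftrightarrow>
     x 0 = z \<and> (\<forall>t\<ge>0. (x has_vector_derivative f (x t) \<alpha>) (at t within {0..}))"

(* For f Lipschitz in the state, the solution exists and is unique on [0, oo); its values at
   negative times are unspecified and never used. *)
definition exact_solution ::
  "('a::euclidean_space \<Rightarrow> 'p \<Rightarrow> 'a) \<Rightarrow> 'p \<Rightarrow> 'a \<Rightarrow> real \<Rightarrow> 'a" where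
  "exact_solution f \<alpha> z = (SOME x. solves_ivp f \<alpha> z x)"

definition flow_map ::
  "('a::euclidean_space \<Rightarrow> 'p \<Rightarrow> 'a) \<Rightarrow> real \<Rightarrow> 'a \<Rightarrow> 'p \<Rightarrow> 'a" where
  "flow_map f s z \<alpha> = exact_solution f \<alpha> z s"

definition effective_increment ::
  "('a::euclidean_space \<Rightarrow> 'p \<Rightarrow> 'a) \<Rightarrow> 'a \<Rightarrow> 'p \<Rightarrow> real \<Rightarrow> 'a" where
  "effective_increment f z \<alpha> \<delta> = integral {0..\<delta>} (\<lambda>s. f (flow_map f s z \<alpha>) \<alpha>)"

(* hidden_layer m h: h maps the network input to the output of a hidden layer with m neurons.
   Layer outputs are encoded as functions nat => real of which only the entries below m are
   read by the next layer.  Every layer is an affine map followed by an activation function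
   sigma applied to each component; sigma may change from layer to layer.  On the input space an
   affine functional is an inner product plus a constant. *)
inductive hidden_layer :: "nat \<Rightarrow> ('a::euclidean_space \<Rightarrow> nat \<Rightarrow> real) \<Rightarrow> bool" where
  first: "hidden_layer m (\<lambda>z i. \<sigma> (w i \<bullet> z + b i))"
| deeper: "hidden_layer m h \<Longrightarrow> hidden_layer m' (\<lambda>z i. \<sigma> ((\<Sum>j<m. W i j * h z j) + b i))"

(* The output layer is affine without activation; the first disjunct is the case of no hidden
   layer.  The vectors W j are the columns of the weight matrix of the output layer. *)
definition feedforward_network ::
  "('a::euclidean_space \<Rightarrow> 'b::euclidean_space) \<Rightarrow> bool" where
  "feedforward_network N \<longleftrightarrow>
     (\<exists>A b. linear A \<and> N = (\<lambda>z. A z + b)) \<or>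
     (\<exists>m h W b. hidden_layer m h \<and> N = (\<lambda>z. (\<Sum>j<m. h z j *\<^sub>R W j) + b))"

(* The prediction is indexed by the step number k rather than by the time t_k, since the t_k
   need not be distinct when a time lag is 0. *)
primrec network_prediction ::
  "('a::real_vector \<times> 'p \<times> real \<Rightarrow> 'a) \<Rightarrow> (nat \<Rightarrow> real) \<Rightarrow> 'a \<Rightarrow> 'p \<Rightarrow> nat \<Rightarrow> 'a" where
  "network_prediction N \<delta> x0 \<alpha> 0 = x0"
| "network_prediction N \<delta> x0 \<alpha> (Suc k) =
     network_prediction N \<delta> x0 \<alpha> k + N (network_prediction N \<delta> x0 \<alpha> k, \<alpha>, \<delta> k)"

definition probability_density_on :: "'p::euclidean_space set \<Rightarrow> ('p \<Rightarrow> real) \<Rightarrow> bool" where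
  "probability_density_on I \<rho> \<longleftrightarrow>
     (\<forall>y\<in>I. 0 \<le> \<rho> y) \<and> integrable (lebesgue_on I) \<rho> \<and> (LINT y|lebesgue_on I. \<rho> y) = 1"

definition expectation_on ::
  "'p::euclidean_space set \<Rightarrow> ('p \<Rightarrow> real) \<Rightarrow> ('p \<Rightarrow> real^'d) \<Rightarrow> real^'d" where
  "expectation_on I \<rho> g = (LINT y|lebesgue_on I. \<rho> y *\<^sub>R g y)"

definition variance_on ::
  "'p::euclidean_space set \<Rightarrow> ('p \<Rightarrow> real) \<Rightarrow> ('p \<Rightarrow> real^'d) \<Rightarrow> real^'d" where
  "variance_on I \<rho> g =
     (LINT y|lebesgue_on I. \<rho> y *\<^sub>R (\<chi> i. (g y $ i - expectation_on I \<rho> g $ i)\<^sup>2))"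

definition Linf_norm_on ::
  "'p::euclidean_space set \<Rightarrow> ('p \<Rightarrow> 'b::real_normed_vector) \<Rightarrow> ereal" where
  "Linf_norm_on I g = esssup (lebesgue_on I) (\<lambda>y. ereal (norm (g y)))"

definition error_constant :: "nat \<Rightarrow> real \<Rightarrow> real \<Rightarrow> real" where
  "error_constant n L \<Delta> = (exp (real n * L * \<Delta>) - 1) / (exp (L * \<Delta>) - 1)"

end

theory Submission
  imports Defs "HOL-Probability.Probability_Measure"
begin

text \<open>
  Two solutions of the same Lipschitz system separate at most by the factor \<open>exp (L * \<delta>)\<close> over a
  time step \<open>\<delta>\<close>, and the network misses the exact step by at most \<open>\<epsilon>\<close>. Hence the error \<open>e k\<close> after
  \<open>k\<close> steps satisfies \<open>e (Suc k) \<le> exp (L * \<Delta>) * e k + \<epsilon>\<close>, whose solution is the geometric sum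
  \<open>error_constant k L \<Delta> * \<epsilon>\<close>. Integrating this pointwise bound gives the estimate of the mean; for
  the variance, write \<open>Y = X + D\<close> and expand \<open>Var Y - Var X = Var D + 2 Cov X D\<close>.
\<close>

section \<open>Lipschitz initial value problems\<close>

text \<open>Differentiability within a set is local, so the half-line of \<open>solves_ivp\<close>
  can be cut to a compact interval; the end \<open>t+1\<close> keeps \<open>t\<close> off its right
  boundary.\<close>

lemma integral_has_vector_derivative_atLeast:
  fixes g :: "real \<Rightarrow> 'a::euclidean_space"
  assumes "continuous_on {0..} g" "0 \<le> t"
  shows "((\<lambda>t. integral {0..t} g) has_vector_derivative g t) (at t within {0..})"
proof -
  have "((\<lambda>t. integral {0..t} g) has_vector_derivative g t) (at t within {0..t+1})"
    by (rule integral_has_vector_derivative)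
      (use assms in \<open>auto intro: continuous_on_subset\<close>)
  moreover have "at t within {0..} = at t within {0..t+1}"
    by (rule at_within_nhd[of _ "{t-1<..<t+1}"]) (use assms in auto)
  ultimately show ?thesis by simp
qed

lemma lipschitz_on_UNIV_norm:
  fixes F :: "'a::real_normed_vector \<Rightarrow> 'b::real_normed_vector"
  assumes "L-lipschitz_on UNIV F"
  shows "norm (F x - F y) \<le> L * norm (x - y)"
  using lipschitz_onD[OF assms] by (simp add: dist_norm)

lemma integral_exp_atLeastAtMost:
  fixes c t :: real
  assumes "c \<noteq> 0" "0 \<le> t"
  shows "((\<lambda>s. exp (c * s)) has_integral (exp (c * t) - 1) / c) {0..t}"
proof -
  have "((\<lambda>s. exp (c * s)) has_integral exp (c * t) / c - exp (c * 0) / c) {0..t}"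
    by (rule fundamental_theorem_of_calculus)
      (use assms in \<open>auto intro!: derivative_eq_intros
        simp: has_real_derivative_iff_has_vector_derivative[symmetric]\<close>)
  then show ?thesis by (simp add: diff_divide_distrib)
qed

text \<open>
  Picard's operator for \<open>y t = exp (- 2 L t) (x t - z)\<close>: in this weighted variable it is a
  contraction with factor \<open>1/2\<close> on the bounded continuous functions on the whole time axis, so a
  single application of Banach's theorem gives the global solution.
\<close>
definition picard ::
  "('a::euclidean_space \<Rightarrow> 'a) \<Rightarrow> real \<Rightarrow> 'a \<Rightarrow> (real \<Rightarrow> 'a) \<Rightarrow> real \<Rightarrow> 'a" where
  "picard F L z y t =
     exp (- 2 * L * max 0 t) *\<^sub>R integral {0..max 0 t} (\<lambda>s. F (z + exp (2 * L * s) *\<^sub>R y s))"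

lemma continuous_on_picard_integrand:
  fixes F :: "'a::euclidean_space \<Rightarrow> 'a"
  assumes "L-lipschitz_on UNIV F" "continuous_on S y"
  shows "continuous_on S (\<lambda>s. F (z + exp (2 * L * s) *\<^sub>R y s))"
  by (rule continuous_on_compose2[OF lipschitz_on_continuous_on[OF assms(1)]])
    (auto intro!: continuous_intros assms)

text \<open>The growth of the weight pays for the integration: what remains is the factor
  \<open>1 / (2 * L)\<close>, uniformly in \<open>t\<close>. It serves with \<open>M\<close> a
  growth bound, to stay among bounded functions, and with \<open>M = L * dist u v\<close>, for the
  contraction.\<close>

lemma norm_weighted_integral_le:
  fixes g :: "real \<Rightarrow> 'a::euclidean_space"
  assumes "0 < L" "0 \<le> t" "continuous_on {0..t} g" "0 \<le> M"
    and "\<And>s. 0 \<le> s \<Longrightarrow> s \<le> t \<Longrightarrow> norm (g s) \<le> M * exp (2 * L * s)"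
  shows "norm (exp (- 2 * L * t) *\<^sub>R integral {0..t} g) \<le> M / (2 * L)"
proof -
  have hi: "((\<lambda>s. M * exp (2 * L * s)) has_integral M * ((exp (2 * L * t) - 1) / (2 * L))) {0..t}"
    using has_integral_mult_right[OF integral_exp_atLeastAtMost[of "2 * L" t], of M] assms by simp
  have "norm (integral {0..t} g) \<le> M * ((exp (2 * L * t) - 1) / (2 * L))"
    using integral_norm_bound_integral[OF integrable_continuous_real[OF assms(3)]
        has_integral_integrable[OF hi]] assms(5) integral_unique[OF hi] by simp
  also have "\<dots> \<le> M * (exp (2 * L * t) / (2 * L))"
    using assms by (intro mult_left_mono divide_right_mono) auto
  finally have "exp (- 2 * L * t) * norm (integral {0..t} g)
      \<le> exp (- 2 * L * t) * (M * (exp (2 * L * t) / (2 * L)))"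
    by (intro mult_left_mono) auto
  also have "\<dots> = M / (2 * L)"
    by (simp add: exp_minus field_simps)
  finally show ?thesis by simp
qed

lemma picard_bcontfun:
  fixes F :: "'a::euclidean_space \<Rightarrow> 'a"
  assumes F: "L-lipschitz_on UNIV F" and L: "0 < L" and y: "y \<in> bcontfun"
  shows "picard F L z y \<in> bcontfun"
proof -
  define g where "g = (\<lambda>s. F (z + exp (2 * L * s) *\<^sub>R y s))"
  have cy: "continuous_on UNIV y" and "bounded (range y)"
    using y by (auto simp: bcontfun_def)
  then obtain B where B: "\<And>s. norm (y s) \<le> B"
    by (auto simp: bounded_iff)
  have B0: "0 \<le> B" using B[of 0] norm_ge_zero order_trans by blast
  have cg: "continuous_on S g" for S
    unfolding g_def using continuous_on_picard_integrand[OF F] cy continuous_on_subset by blast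
  have "continuous_on {0..} (\<lambda>t. integral {0..t} g)"
    unfolding continuous_on_eq_continuous_within
    using integral_has_vector_derivative_atLeast[OF cg] has_vector_derivative_continuous by blast
  \<comment> \<open>Clamping the time with \<open>max 0\<close> makes the integral vanish at
    negative times, so continuity on the half-line extends to the whole line, as
    \<open>bcontfun\<close> demands.\<close>
  then have "continuous_on UNIV (\<lambda>t. integral {0..max 0 t} g)"
    by (rule continuous_on_compose2) (auto intro!: continuous_intros)
  then have cont: "continuous_on UNIV (picard F L z y)"
    unfolding picard_def g_def by (auto intro!: continuous_intros)
  have "norm (picard F L z y t) \<le> (norm (F z) + L * B) / (2 * L)" for t
    unfolding picard_def g_def[symmetric]
  proof (rule norm_weighted_integral_le[OF L _ cg])
    fix s :: real assume s: "0 \<le> s"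
    have "norm (g s) \<le> norm (F z) + norm (g s - F z)"
      using norm_triangle_ineq[of "F z" "g s - F z"] by simp
    also have "norm (g s - F z) \<le> L * (exp (2 * L * s) * norm (y s))"
      using lipschitz_on_UNIV_norm[OF F, of "z + exp (2 * L * s) *\<^sub>R y s" z] by (simp add: g_def)
    also have "\<dots> \<le> L * (exp (2 * L * s) * B)"
      using L B by (intro mult_left_mono) auto
    \<comment> \<open>The weight is at least 1 for nonnegative \<open>s\<close>, so the constant
      part of the growth bound can be put under it too.\<close>
    also have "norm (F z) \<le> norm (F z) * exp (2 * L * s)"
      using L s mult_left_mono[of 1 "exp (2 * L * s)" "norm (F z)"] by simp
    finally show "norm (g s) \<le> (norm (F z) + L * B) * exp (2 * L * s)"
      by (simp add: algebra_simps)
  qed (use L B0 in auto)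
  then show ?thesis
    using cont by (auto simp: bcontfun_def bounded_iff)
qed

text \<open>The Lipschitz bound costs \<open>L\<close> and the weighted integral returns
  \<open>1 / (2 * L)\<close>: the rate \<open>2 * L\<close> of the weight is chosen to make the
  product \<open>1 / 2\<close>.\<close>

lemma picard_contraction:
  fixes F :: "'a::euclidean_space \<Rightarrow> 'a" and u v :: "real \<Rightarrow>\<^sub>C 'a"
  assumes F: "L-lipschitz_on UNIV F" and L: "0 < L"
  shows "norm (picard F L z u t - picard F L z v t) \<le> 1 / 2 * dist u v"
proof -
  let ?G = "\<lambda>y s. F (z + exp (2 * L * s) *\<^sub>R y s)"
  let ?T = "max 0 t"
  have c: "continuous_on S (?G (apply_bcontfun y))" for y S
    by (rule continuous_on_picard_integrand[OF F]) auto
  have i: "?G (apply_bcontfun y) integrable_on {0..?T}" for y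
    by (rule integrable_continuous_real[OF c])
  have "picard F L z u t - picard F L z v t =
      exp (- 2 * L * ?T) *\<^sub>R integral {0..?T} (\<lambda>s. ?G u s - ?G v s)"
    by (simp add: picard_def integral_diff[OF i i] scaleR_right_diff_distrib)
  also have "norm \<dots> \<le> (L * dist u v) / (2 * L)"
  proof (rule norm_weighted_integral_le[OF L])
    fix s :: real
    have "norm (?G u s - ?G v s) \<le> L * norm (exp (2 * L * s) *\<^sub>R (u s - v s))"
      using lipschitz_on_UNIV_norm[OF F, of "z + exp (2 * L * s) *\<^sub>R u s"
          "z + exp (2 * L * s) *\<^sub>R v s"]
      by (simp add: scaleR_right_diff_distrib)
    also have "\<dots> \<le> L * (exp (2 * L * s) * dist u v)"
      using L dist_bounded[of u s v] by (auto simp: dist_norm intro!: mult_left_mono)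
    finally show "norm (?G u s - ?G v s) \<le> L * dist u v * exp (2 * L * s)"
      by (simp add: algebra_simps)
  qed (use L c in \<open>auto intro!: continuous_on_diff\<close>)
  finally show ?thesis using L by simp
qed

text \<open>Existence is what turns the choice made in \<open>exact_solution\<close> into a
  solution.\<close>

lemma solves_ivp_exists:
  fixes f :: "'a::euclidean_space \<Rightarrow> 'p \<Rightarrow> 'a"
  assumes F: "L-lipschitz_on UNIV (\<lambda>x. f x \<alpha>)" and L: "0 < L"
  shows "\<exists>x. solves_ivp f \<alpha> z x"
proof -
  let ?P = "picard (\<lambda>x. f x \<alpha>) L z"
  \<comment> \<open>\<open>Bcontfun\<close> is inverse to \<open>apply_bcontfun\<close> only on
    bounded continuous functions, hence the appeal to \<open>picard_bcontfun\<close>.\<close>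
  have P: "apply_bcontfun (Bcontfun (?P (apply_bcontfun y))) = ?P (apply_bcontfun y)" for y
    by (simp add: Bcontfun_inverse picard_bcontfun[OF F L] apply_bcontfun)
  have "\<exists>!y. y \<in> UNIV \<and> Bcontfun (?P (apply_bcontfun y)) = y"
  proof (rule Banach_fix)
    fix u v :: "real \<Rightarrow>\<^sub>C 'a"
    show "dist (Bcontfun (?P u)) (Bcontfun (?P v)) \<le> 1 / 2 * dist u v"
      by (rule dist_bound) (use picard_contraction[OF F L] in \<open>simp add: P dist_norm[of "_ :: 'a"]\<close>)
  qed auto
  then obtain y where "Bcontfun (?P (apply_bcontfun y)) = y"
    by blast
  then have y: "apply_bcontfun y = ?P (apply_bcontfun y)"
    using P[of y] by simp
  \<comment> \<open>Undoing the weight turns the fixed-point equation into the integral form of the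
    initial value problem.\<close>
  define x where "x = (\<lambda>t. z + exp (2 * L * t) *\<^sub>R y t)"
  have c: "continuous_on {0..} (\<lambda>s. f (x s) \<alpha>)"
    unfolding x_def by (rule continuous_on_picard_integrand[OF F]) auto
  have x: "x t = z + integral {0..t} (\<lambda>s. f (x s) \<alpha>)" if "0 \<le> t" for t
  proof -
    have "y t = exp (- 2 * L * t) *\<^sub>R integral {0..t} (\<lambda>s. f (x s) \<alpha>)"
      using that fun_cong[OF y, of t] by (simp add: picard_def x_def)
    then show ?thesis by (simp add: x_def[THEN fun_cong, of t] exp_minus)
  qed
  have "(x has_vector_derivative f (x t) \<alpha>) (at t within {0..})" if "0 \<le> t" for t
  proof -
    have "((\<lambda>t. z + integral {0..t} (\<lambda>s. f (x s) \<alpha>)) has_vector_derivative 0 + f (x t) \<alpha>)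
        (at t within {0..})"
      by (intro has_vector_derivative_add has_vector_derivative_const
          integral_has_vector_derivative_atLeast c that)
    then show ?thesis
      using that x by (intro has_vector_derivative_transform[of t "{0..}" x]) auto
  qed
  then show ?thesis
    using x[of 0] by (auto simp: solves_ivp_def)
qed

lemma exact_solution_solves:
  fixes f :: "'a::euclidean_space \<Rightarrow> 'p \<Rightarrow> 'a"
  assumes "L-lipschitz_on UNIV (\<lambda>x. f x \<alpha>)" "0 < L"
  shows "solves_ivp f \<alpha> z (exact_solution f \<alpha> z)"
  unfolding exact_solution_def using solves_ivp_exists[where f = f and \<alpha> = \<alpha>, OF assms] by (rule someI_ex)

section \<open>Restarting, stability and the flow map\<close>

text \<open>The system is autonomous, so an exact trajectory may be restarted from any state it has
  reached.\<close>

lemma solves_ivp_shift: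
  assumes "solves_ivp f \<alpha> z x" "0 \<le> r"
  shows "solves_ivp f \<alpha> (x r) (\<lambda>s. x (r + s))"
  unfolding solves_ivp_def
proof (intro conjI allI impI)
  fix t :: real assume "0 \<le> t"
  then have "(x has_vector_derivative f (x (r + t)) \<alpha>) (at (r + t) within {0..})"
    using assms by (simp add: solves_ivp_def)
  \<comment> \<open>The chain rule asks for the derivative within the shifted half-line, which lies
    in \<open>{0..}\<close> because \<open>r\<close> is nonnegative.\<close>
  then have "(x has_vector_derivative f (x (r + t)) \<alpha>) (at (r + t) within (\<lambda>s. r + s) ` {0..})"
    by (rule has_vector_derivative_within_subset) (use assms in auto)
  moreover have "((\<lambda>s. r + s) has_vector_derivative 1) (at t within {0..})"
    by (auto intro!: derivative_eq_intros)
  ultimately show "((\<lambda>s. x (r + s)) has_vector_derivative f (x (r + t)) \<alpha>) (at t within {0..})"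
    using vector_diff_chain_within[of "\<lambda>s. r + s" 1 t "{0..}" x] by (simp add: o_def)
qed simp

lemma solves_ivp_continuous_on:
  assumes "solves_ivp f \<alpha> z x"
  shows "continuous_on {0..} x"
  unfolding continuous_on_eq_continuous_within
  using assms has_vector_derivative_continuous by (fastforce simp: solves_ivp_def)

text \<open>A Gronwall estimate in differential form: the squared distance, discounted at rate
  \<open>2 * L\<close>, does not increase. The square avoids the norm, which is not differentiable
  at 0.\<close>

lemma solves_ivp_stability:
  fixes f :: "'a::euclidean_space \<Rightarrow> 'p \<Rightarrow> 'a"
  assumes F: "L-lipschitz_on UNIV (\<lambda>x. f x \<alpha>)"
    and u: "solves_ivp f \<alpha> z u" and v: "solves_ivp f \<alpha> w v" and t: "0 \<le> t"
  shows "norm (u t - v t) \<le> exp (L * t) * norm (z - w)"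
proof -
  define p where "p = (\<lambda>t. exp (- 2 * L * t) * ((u t - v t) \<bullet> (u t - v t)))"
  have "p t \<le> p 0"
  proof (rule DERIV_nonpos_imp_decreasing_open[OF t])
    fix s assume s: "0 < s" "s < t"
    define e where "e = u s - v s"
    define d where "d = f (u s) \<alpha> - f (v s) \<alpha>"
    \<comment> \<open>At interior times the derivative relative to the half-line is a full one;
      continuity of \<open>p\<close> takes care of the endpoints.\<close>
    have "at s within {0..} = at s"
      using s by (intro at_within_interior) (auto simp: interior_Ici)
    then have "(u has_vector_derivative f (u s) \<alpha>) (at s)"
        "(v has_vector_derivative f (v s) \<alpha>) (at s)"
      using u v s by (auto simp: solves_ivp_def dest!: spec[of _ s])
    then have du: "((\<lambda>s. u s - v s) has_derivative (\<lambda>h. h *\<^sub>R d)) (at s)"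
      unfolding d_def using has_vector_derivative_diff has_vector_derivative_def by blast
    have "(p has_derivative
        (\<lambda>h. h * (exp (- 2 * L * s) * (2 * (e \<bullet> d) - 2 * L * (e \<bullet> e))))) (at s)"
      unfolding p_def
      by (rule derivative_eq_intros du refl)+
        (auto simp: e_def d_def algebra_simps inner_commute)
    then have "(p has_real_derivative exp (- 2 * L * s) * (2 * (e \<bullet> d) - 2 * L * (e \<bullet> e))) (at s)"
      by (simp only: has_field_derivative_def mult_commute_abs)
    \<comment> \<open>By Cauchy-Schwarz and the Lipschitz bound the squared distance grows at rate
      at most \<open>2 * L\<close>, which is exactly the discount.\<close>
    moreover have "e \<bullet> d \<le> norm e * (L * norm e)"
      using norm_cauchy_schwarz[of e d] lipschitz_on_UNIV_norm[OF F, of "u s" "v s"]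
        mult_left_mono[of "norm d" "L * norm e" "norm e"]
      by (simp add: e_def d_def)
    then have "2 * (e \<bullet> d) - 2 * L * (e \<bullet> e) \<le> 0"
      by (simp add: dot_square_norm power2_eq_square algebra_simps)
    then have "exp (- 2 * L * s) * (2 * (e \<bullet> d) - 2 * L * (e \<bullet> e)) \<le> 0"
      by (intro mult_nonneg_nonpos) auto
    ultimately show "\<exists>y. (p has_real_derivative y) (at s) \<and> y \<le> 0" by blast
  next
    show "continuous_on {0..t} p"
      unfolding p_def
      using solves_ivp_continuous_on[OF u] solves_ivp_continuous_on[OF v]
      by (auto intro!: continuous_intros intro: continuous_on_subset)
  qed
  then have "exp (- 2 * L * t) * (norm (u t - v t))\<^sup>2 \<le> (norm (z - w))\<^sup>2"
    using u v by (simp add: p_def solves_ivp_def dot_square_norm)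
  then have "(norm (u t - v t))\<^sup>2 \<le> exp (2 * L * t) * (norm (z - w))\<^sup>2"
    by (simp add: exp_minus field_simps)
  also have "exp (2 * L * t) = (exp (L * t))\<^sup>2"
    by (simp add: exp_double[symmetric] mult.assoc)
  finally have "(norm (u t - v t))\<^sup>2 \<le> (exp (L * t) * norm (z - w))\<^sup>2"
    by (simp add: power_mult_distrib)
  then show ?thesis
    by (rule power2_le_imp_le) simp
qed

text \<open>Through this identity the hypothesis on the network, stated for increments, becomes a
  bound on the distance to the exact step.\<close>

lemma flow_map_effective_increment:
  fixes f :: "'a::euclidean_space \<Rightarrow> 'p \<Rightarrow> 'a"
  assumes "L-lipschitz_on UNIV (\<lambda>x. f x \<alpha>)" "0 < L" "0 \<le> \<delta>"
  shows "flow_map f \<delta> z \<alpha> = z + effective_increment f z \<alpha> \<delta>"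
proof -
  have s: "solves_ivp f \<alpha> z (exact_solution f \<alpha> z)"
    by (rule exact_solution_solves[where f = f and \<alpha> = \<alpha>, OF assms(1,2)])
  have "((\<lambda>s. f (exact_solution f \<alpha> z s) \<alpha>) has_integral
      exact_solution f \<alpha> z \<delta> - exact_solution f \<alpha> z 0) {0..\<delta>}"
    using s assms(3) unfolding solves_ivp_def
    by (intro fundamental_theorem_of_calculus)
      (auto intro: has_vector_derivative_within_subset)
  then show ?thesis
    using s by (simp add: effective_increment_def flow_map_def integral_unique solves_ivp_def)
qed

section \<open>Accumulation of the one-step errors\<close>

text \<open>The constant is the geometric sum of the powers of \<open>exp (L * \<Delta>)\<close>
  with exponents below \<open>n\<close>. Positivity of \<open>L\<close> and \<open>\<Delta>\<close>
  keeps the denominator nonzero.\<close>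

lemma error_constant_Suc:
  assumes "0 < L" "0 < \<Delta>"
  shows "error_constant (Suc n) L \<Delta> = exp (L * \<Delta>) * error_constant n L \<Delta> + 1"
proof -
  have "exp (L * \<Delta>) - 1 \<noteq> 0" using assms by simp
  then show ?thesis
    by (simp add: error_constant_def divide_simps) (simp add: algebra_simps exp_add[symmetric])
qed

text \<open>Approximation is asked for only at the states visited before step \<open>n\<close>. The
  intermediate point of the triangle inequality is the exact solution started at the last
  prediction.\<close>

lemma network_prediction_error:
  fixes f :: "'a::euclidean_space \<Rightarrow> 'p \<Rightarrow> 'a"
  assumes F: "L-lipschitz_on UNIV (\<lambda>x. f x \<alpha>)" and L: "0 < L" and \<Delta>: "0 < \<Delta>"
    and \<delta>: "\<And>k. k < n \<Longrightarrow> 0 \<le> \<delta> k \<and> \<delta> k \<le> \<Delta>"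
    and N: "\<And>k. k < n \<Longrightarrow> norm (N (network_prediction N \<delta> x0 \<alpha> k, \<alpha>, \<delta> k)
      - effective_increment f (network_prediction N \<delta> x0 \<alpha> k) \<alpha> (\<delta> k)) \<le> \<epsilon>"
  shows "norm (exact_solution f \<alpha> x0 (\<Sum>k<n. \<delta> k) - network_prediction N \<delta> x0 \<alpha> n)
    \<le> error_constant n L \<Delta> * \<epsilon>"
proof -
  note sol = exact_solution_solves[where f = f and \<alpha> = \<alpha>, OF F L]
  show ?thesis
    using \<delta> N
  proof (induction n)
    case 0
    then show ?case
      using sol[of x0] by (simp add: solves_ivp_def error_constant_def)
  next
    case (Suc n)
    let ?t = "\<Sum>k<n. \<delta> k"
    let ?x = "exact_solution f \<alpha> x0"
    let ?p = "network_prediction N \<delta> x0 \<alpha> n"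
    have \<delta>: "0 \<le> \<delta> n" "\<delta> n \<le> \<Delta>" using Suc.prems(1)[of n] by auto
    have "0 \<le> ?t" using Suc.prems(1) by (intro sum_nonneg) auto
    \<comment> \<open>Propagated error: the exact trajectory restarted at time \<open>?t\<close>
      against the exact trajectory from \<open>?p\<close>.\<close>
    then have "norm (?x (?t + \<delta> n) - exact_solution f \<alpha> ?p (\<delta> n)) \<le> exp (L * \<delta> n) * norm (?x ?t - ?p)"
      using solves_ivp_stability[where f = f and \<alpha> = \<alpha>,
          OF F solves_ivp_shift[OF sol] sol \<delta>(1)] by blast
    \<comment> \<open>Enlarging the lag to \<open>\<Delta>\<close> makes the recursion the same at
      every step.\<close>
    also have "\<dots> \<le> exp (L * \<Delta>) * (error_constant n L \<Delta> * \<epsilon>)"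
      using L \<delta> Suc by (intro mult_mono) auto
    finally have 1: "norm (?x (?t + \<delta> n) - exact_solution f \<alpha> ?p (\<delta> n))
      \<le> exp (L * \<Delta>) * (error_constant n L \<Delta> * \<epsilon>)" .
    \<comment> \<open>Local error: both the exact step and the network step start at
      \<open>?p\<close>.\<close>
    have 2: "norm (exact_solution f \<alpha> ?p (\<delta> n) - network_prediction N \<delta> x0 \<alpha> (Suc n)) \<le> \<epsilon>"
      using Suc.prems(2)[of n] flow_map_effective_increment[where f = f and \<alpha> = \<alpha>, OF F L \<delta>(1)]
      by (simp add: flow_map_def norm_minus_commute)
    show ?case
      using norm_diff_triangle_le[OF 1 2] by (simp add: error_constant_Suc[OF L \<Delta>] algebra_simps)
  qed
qed

section \<open>Perturbation of mean and variance\<close>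

text \<open>The componentwise square in \<open>variance_on\<close> is the diagonal of this bilinear
  map. Bilinearity lets the scalar calculus of variances run on vectors without passing to
  coordinates.\<close>

definition hadamard :: "real^'d \<Rightarrow> real^'d \<Rightarrow> real^'d" where
  "hadamard x y = (\<chi> i. x $ i * y $ i)"

text \<open>Each coordinate of \<open>x\<close> is bounded by the norm of \<open>x\<close>, so the
  constant is 1 and the final bounds do not depend on the dimension.\<close>

lemma norm_hadamard_le: "norm (hadamard x y) \<le> norm x * norm y"
proof -
  have "norm (hadamard x y) \<le> norm (norm x *\<^sub>R y)"
    using component_le_norm_cart[of x]
    by (intro norm_le_componentwise_cart) (auto simp: hadamard_def abs_mult intro!: mult_right_mono)
  then show ?thesis by simp
qed

lemma bounded_bilinear_hadamard: "bounded_bilinear (hadamard :: real^'d \<Rightarrow> _)"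
proof (rule bounded_bilinear.intro)
  show "\<exists>K. \<forall>a b :: real^'d. norm (hadamard a b) \<le> norm a * norm b * K"
    using norm_hadamard_le by (intro exI[of _ 1]) (auto simp only: mult_1_right)
qed (auto simp: hadamard_def vec_eq_iff algebra_simps)

interpretation hadamard: bounded_bilinear hadamard
  by (rule bounded_bilinear_hadamard)

lemma hadamard_commute: "hadamard x y = hadamard y x"
  by (simp add: hadamard_def mult.commute)

lemma hadamard_add_self:
  "hadamard (x + y) (x + y) = hadamard x x + 2 *\<^sub>R hadamard x y + hadamard y y"
  by (simp add: hadamard.add_left hadamard.add_right hadamard_commute[of y x] scaleR_2)

lemma hadamard_diff_self:
  "hadamard (x - y) (x - y) = hadamard x x - 2 *\<^sub>R hadamard x y + hadamard y y"
  by (simp add: hadamard.diff_left hadamard.diff_right hadamard_commute[of y x] scaleR_2)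

context prob_space
begin

lemma norm_expectation_le:
  fixes g :: "'a \<Rightarrow> real^'d"
  assumes "AE x in M. norm (g x) \<le> B"
  shows "norm (expectation g) \<le> B"
proof (cases "integrable M g")
  case True
  have "norm (expectation g) \<le> (\<integral>x. norm (g x) \<partial>M)" by (rule integral_norm_bound)
  also have "\<dots> \<le> (\<integral>x. B \<partial>M)" using True assms by (intro integral_mono_AE) auto
  finally show ?thesis by (simp add: prob_space)
next
  case False
  \<comment> \<open>A non-integrable function has integral 0 by convention, so only the sign of
    \<open>B\<close> matters; a probability space is not null, so an almost sure sign of a constant
    is its sign.\<close>
  have "AE x in M. 0 \<le> B"
    using assms by eventually_elim (rule order_trans[OF norm_ge_zero])
  then show ?thesis using False by (simp add: not_integrable_integral_eq)
qed

lemma norm_hadamard_AE_le: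
  assumes "AE x in M. norm (X x) \<le> B" "AE x in M. norm (Y x) \<le> c"
  shows "AE x in M. norm (hadamard (X x) (Y x)) \<le> B * c"
  using assms
proof eventually_elim
  case (elim x)
  then show ?case
    using norm_hadamard_le[of "X x" "Y x"] mult_mono[of "norm (X x)" B "norm (Y x)" c]
    by (smt (verit) norm_ge_zero)
qed

lemma integrable_hadamard:
  assumes [measurable]: "X \<in> borel_measurable M" "Y \<in> borel_measurable M"
    and "AE x in M. norm (X x) \<le> B" "AE x in M. norm (Y x) \<le> c"
  shows "integrable M (\<lambda>x. hadamard (X x) (Y x))"
proof (rule integrable_const_bound)
  show "AE x in M. norm (hadamard (X x) (Y x)) \<le> B * c"
    using norm_hadamard_AE_le assms by blast
  show "(\<lambda>x. hadamard (X x) (Y x)) \<in> borel_measurable M"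
    by (rule borel_measurable_continuous_Pair[OF assms(1,2)])
      (auto intro!: hadamard.continuous_on continuous_intros)
qed

lemma expectation_hadamard_centered:
  assumes "integrable M X" "integrable M (\<lambda>x. hadamard (X x) (X x))"
  shows "expectation (\<lambda>x. hadamard (X x - expectation X) (X x - expectation X))
    = expectation (\<lambda>x. hadamard (X x) (X x)) - hadamard (expectation X) (expectation X)"
proof -
  define m where "m = expectation X"
  have i: "integrable M (\<lambda>x. hadamard (X x) m)"
    and e: "expectation (\<lambda>x. hadamard (X x) m) = hadamard m m"
    using assms(1) integral_bounded_linear[OF hadamard.bounded_linear_left assms(1)]
      integrable_bounded_linear[OF hadamard.bounded_linear_left assms(1)]
    by (auto simp: m_def)
  have "(\<lambda>x. hadamard (X x - m) (X x - m))
      = (\<lambda>x. hadamard (X x) (X x) - 2 *\<^sub>R hadamard (X x) m + hadamard m m)"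
    by (simp add: hadamard_diff_self)
  then have "expectation (\<lambda>x. hadamard (X x - m) (X x - m))
      = expectation (\<lambda>x. hadamard (X x) (X x)) - 2 *\<^sub>R hadamard m m + hadamard m m"
    using i e assms by (simp add: prob_space)
  then show ?thesis
    by (simp add: m_def[symmetric] scaleR_2)
qed

text \<open>With \<open>Y = X + D\<close> the terms quadratic in \<open>X\<close> cancel, leaving
  the variance of \<open>D\<close> and twice a covariance, up to sign. In each, the product of means
  and the mean of the product are bounded separately, whence the factors 2 and 4.\<close>

lemma variance_perturbation:
  fixes X Y :: "'a \<Rightarrow> real^'d"
  assumes X [measurable]: "X \<in> borel_measurable M" and Y [measurable]: "Y \<in> borel_measurable M"
    and B: "AE x in M. norm (X x) \<le> B" and c: "AE x in M. norm (X x - Y x) \<le> c"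
  shows "norm (expectation (\<lambda>x. hadamard (X x - expectation X) (X x - expectation X))
      - expectation (\<lambda>x. hadamard (Y x - expectation Y) (Y x - expectation Y)))
    \<le> 2 * c\<^sup>2 + 4 * c * B"
proof -
  define D where "D = (\<lambda>x. Y x - X x)"
  have D [measurable]: "D \<in> borel_measurable M" by (simp add: D_def)
  have c: "AE x in M. norm (D x) \<le> c" using c by (simp add: D_def norm_minus_commute)
  note i = integrable_const_bound[OF B X] integrable_const_bound[OF c D]
    integrable_hadamard[OF X X B B] integrable_hadamard[OF X D B c] integrable_hadamard[OF D D c c]
  note n = norm_expectation_le[OF B] norm_expectation_le[OF c]
  have B0: "0 \<le> B" and c0: "0 \<le> c"
    using n norm_ge_zero order_trans by blast+
  let ?E = "expectation"
  have Y: "Y = (\<lambda>x. X x + D x)" by (simp add: D_def)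
  have YY: "(\<lambda>x. hadamard (Y x) (Y x)) = (\<lambda>x. hadamard (X x) (X x)
      + 2 *\<^sub>R hadamard (X x) (D x) + hadamard (D x) (D x))"
    by (simp add: Y hadamard_add_self)
  have "integrable M Y" unfolding Y using i by simp
  moreover have "integrable M (\<lambda>x. hadamard (Y x) (Y x))" unfolding YY using i by simp
  ultimately have "?E (\<lambda>x. hadamard (Y x - ?E Y) (Y x - ?E Y))
      = ?E (\<lambda>x. hadamard (Y x) (Y x)) - hadamard (?E Y) (?E Y)"
    by (rule expectation_hadamard_centered)
  moreover have "?E (\<lambda>x. hadamard (X x - ?E X) (X x - ?E X))
      = ?E (\<lambda>x. hadamard (X x) (X x)) - hadamard (?E X) (?E X)"
    using i by (intro expectation_hadamard_centered)
  moreover have "?E Y = ?E X + ?E D" unfolding Y using i by simp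
  moreover have "?E (\<lambda>x. hadamard (Y x) (Y x)) = ?E (\<lambda>x. hadamard (X x) (X x))
      + 2 *\<^sub>R ?E (\<lambda>x. hadamard (X x) (D x)) + ?E (\<lambda>x. hadamard (D x) (D x))"
    unfolding YY using i by simp
  ultimately have "expectation (\<lambda>x. hadamard (X x - expectation X) (X x - expectation X))
      - expectation (\<lambda>x. hadamard (Y x - expectation Y) (Y x - expectation Y))
    = hadamard (?E D) (?E D) - ?E (\<lambda>x. hadamard (D x) (D x))
      + 2 *\<^sub>R (hadamard (?E X) (?E D) - ?E (\<lambda>x. hadamard (X x) (D x)))"
    by (simp only: hadamard_add_self scaleR_right_diff_distrib) simp
  also have "norm \<dots> \<le> (c * c + c * c) + 2 * (B * c + B * c)"
  proof -
    \<comment> \<open>Minus the covariance of \<open>Z\<close> and \<open>D\<close>; taken below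
      with \<open>Z = D\<close> and with \<open>Z = X\<close>.\<close>
    have le: "norm (hadamard (?E Z) (?E D) - ?E (\<lambda>x. hadamard (Z x) (D x))) \<le> b * c + b * c"
      if "AE x in M. norm (Z x) \<le> b" "0 \<le> b" for Z :: "'a \<Rightarrow> real^'d" and b
      using norm_triangle_ineq4[of "hadamard (?E Z) (?E D)" "?E (\<lambda>x. hadamard (Z x) (D x))"]
        norm_expectation_le[OF norm_hadamard_AE_le[OF that(1) c]]
        norm_hadamard_le[of "?E Z" "?E D"]
        mult_mono[OF norm_expectation_le[OF that(1)] n(2) that(2) norm_ge_zero]
      by linarith
    show ?thesis
      using le[OF c c0] le[OF B B0] by (intro norm_triangle_mono) auto
  qed
  finally show ?thesis by (simp add: power2_eq_square algebra_simps)
qed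

end

section \<open>Passing from a density to a probability space\<close>

text \<open>Absorbing the weight into the measure turns both statistics into plain expectations, to
  which the preceding estimates apply.\<close>

lemma
  fixes g :: "real^'l \<Rightarrow> real^'d"
  assumes \<rho>: "probability_density_on I \<rho>"
    and g [measurable]: "g \<in> borel_measurable (lebesgue_on I)"
  shows expectation_on_density:
      "expectation_on I \<rho> g = (LINT y|density (lebesgue_on I) \<rho>. g y)"
    and variance_on_density:
      "variance_on I \<rho> g = (LINT y|density (lebesgue_on I) \<rho>.
        hadamard (g y - (LINT y|density (lebesgue_on I) \<rho>. g y))
          (g y - (LINT y|density (lebesgue_on I) \<rho>. g y)))"
proof -
  have [measurable]: "\<rho> \<in> borel_measurable (lebesgue_on I)"
    using \<rho> by (auto simp: probability_density_on_def)
  \<comment> \<open>The space of \<open>lebesgue_on I\<close> is \<open>I\<close>, where the density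
    is known to be nonnegative.\<close>
  have AE: "AE y in lebesgue_on I. 0 \<le> \<rho> y"
    using \<rho> by (intro AE_I2) (auto simp: probability_density_on_def)
  show e: "expectation_on I \<rho> g = (LINT y|density (lebesgue_on I) \<rho>. g y)"
    unfolding expectation_on_def by (rule integral_density[symmetric]) (use AE in auto)
  have "(\<lambda>y. hadamard (g y - m) (g y - m)) \<in> borel_measurable (lebesgue_on I)" for m
    by (rule borel_measurable_continuous_Pair)
      (auto intro!: hadamard.continuous_on continuous_intros)
  then show "variance_on I \<rho> g = (LINT y|density (lebesgue_on I) \<rho>.
        hadamard (g y - (LINT y|density (lebesgue_on I) \<rho>. g y))
          (g y - (LINT y|density (lebesgue_on I) \<rho>. g y)))"
    using AE by (subst integral_density)
      (auto simp: variance_on_def e hadamard_def power2_eq_square)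
qed

lemma prob_space_density:
  assumes \<rho>: "probability_density_on I \<rho>"
  shows "prob_space (density (lebesgue_on I) \<rho>)"
proof (rule prob_spaceI)
  have "emeasure (density (lebesgue_on I) \<rho>) (space (density (lebesgue_on I) \<rho>))
      = (\<integral>\<^sup>+ y. ennreal (\<rho> y) \<partial>lebesgue_on I)"
    using \<rho> by (subst emeasure_density)
      (auto simp: probability_density_on_def intro!: nn_integral_cong)
  also have "\<dots> = 1"
    using \<rho> by (subst nn_integral_eq_integral)
      (auto simp: probability_density_on_def intro!: AE_I2)
  finally show "emeasure (density (lebesgue_on I) \<rho>) (space (density (lebesgue_on I) \<rho>)) = 1" .
qed

theorem theorem3p3:
  fixes f :: "real^'d \<Rightarrow> real^'l \<Rightarrow> real^'d"
    and Ix :: "(real^'d) set"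
    and Ia :: "(real^'l) set"
    and \<rho> :: "real^'l \<Rightarrow> real"
    and N :: "(real^'d) \<times> (real^'l) \<times> real \<Rightarrow> real^'d"
    and \<delta> :: "nat \<Rightarrow> real"
    and x0 :: "real^'d"
    and a \<Delta> L \<epsilon> Ct t :: real
    and n :: nat
  assumes "Ia \<in> sets lebesgue"
    and "probability_density_on Ia \<rho>"
    and "0 \<le> a" and "a \<le> \<Delta>" and "0 < \<Delta>"
    and "1 \<le> n"
    and "\<forall>k<n. \<delta> k \<in> {a..\<Delta>}"
    and "t = (\<Sum>k<n. \<delta> k)"
    and "0 < L"
    and "\<forall>\<alpha>\<in>Ia. L-lipschitz_on UNIV (\<lambda>x. f x \<alpha>)"
    and "feedforward_network N"
    and "0 < \<epsilon>"
    and "\<forall>z\<in>Ix. \<forall>\<alpha>\<in>Ia. \<forall>s\<in>{a..\<Delta>}. norm (N (z, \<alpha>, s) - effective_increment f z \<alpha> s) \<le> \<epsilon>"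
    and "x0 \<in> Ix"
    and "\<forall>\<alpha>\<in>Ia. \<forall>k<n. network_prediction N \<delta> x0 \<alpha> k \<in> Ix"
    and "(\<lambda>\<alpha>. exact_solution f \<alpha> x0 t) \<in> borel_measurable (lebesgue_on Ia)"
    and "(\<lambda>\<alpha>. network_prediction N \<delta> x0 \<alpha> n) \<in> borel_measurable (lebesgue_on Ia)"
    and "Linf_norm_on Ia (\<lambda>\<alpha>. exact_solution f \<alpha> x0 t) = ereal Ct"
  shows "norm (expectation_on Ia \<rho> (\<lambda>\<alpha>. exact_solution f \<alpha> x0 t)
             - expectation_on Ia \<rho> (\<lambda>\<alpha>. network_prediction N \<delta> x0 \<alpha> n))
           \<le> error_constant n L \<Delta> * \<epsilon>
       \<and> norm (variance_on Ia \<rho> (\<lambda>\<alpha>. exact_solution f \<alpha> x0 t)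
             - variance_on Ia \<rho> (\<lambda>\<alpha>. network_prediction N \<delta> x0 \<alpha> n))
           \<le> 2 * (error_constant n L \<Delta>)\<^sup>2 * \<epsilon>\<^sup>2 + 4 * error_constant n L \<Delta> * Ct * \<epsilon>"
proof -
  let ?M = "density (lebesgue_on Ia) \<rho>"
  let ?X = "\<lambda>\<alpha>. exact_solution f \<alpha> x0 t"
  let ?Y = "\<lambda>\<alpha>. network_prediction N \<delta> x0 \<alpha> n"
  let ?c = "error_constant n L \<Delta> * \<epsilon>"
  interpret prob_space ?M by (rule prob_space_density[OF assms(2)])
  note X = assms(16) and Y = assms(17)
  have \<rho>: "\<rho> \<in> borel_measurable (lebesgue_on Ia)"
    using assms(2) by (auto simp: probability_density_on_def)
  have c: "norm (?X \<alpha> - ?Y \<alpha>) \<le> ?c" if "\<alpha> \<in> Ia" for \<alpha>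
    unfolding assms(8)
  proof (rule network_prediction_error)
    fix k assume "k < n"
    then show "0 \<le> \<delta> k \<and> \<delta> k \<le> \<Delta>"
      using assms(3,7) by fastforce
    \<comment> \<open>The predictions stay in \<open>Ix\<close> by assumption, so the approximation
      bound is available along the whole computed trajectory.\<close>
    show "norm (N (network_prediction N \<delta> x0 \<alpha> k, \<alpha>, \<delta> k)
        - effective_increment f (network_prediction N \<delta> x0 \<alpha> k) \<alpha> (\<delta> k)) \<le> \<epsilon>"
      using assms(7,13,15) that \<open>k < n\<close> by blast
  qed (use assms(5,9,10) that in auto)
  then have c: "AE \<alpha> in ?M. norm (?X \<alpha> - ?Y \<alpha>) \<le> ?c"
    by (intro AE_I2) simp
  \<comment> \<open>The essential supremum is itself an almost everywhere bound, and Lebesgue null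
    sets stay null under a density.\<close>
  have "AE \<alpha> in lebesgue_on Ia. ereal (norm (?X \<alpha>)) \<le> ereal Ct"
    using assms(18) X esssup_AE[of "\<lambda>\<alpha>. ereal (norm (?X \<alpha>))" "lebesgue_on Ia"]
    by (simp add: Linf_norm_on_def)
  then have B: "AE \<alpha> in ?M. norm (?X \<alpha>) \<le> Ct"
    using \<rho> by (subst AE_density) (auto elim: eventually_mono)
  have X': "?X \<in> borel_measurable ?M" and Y': "?Y \<in> borel_measurable ?M"
    using X Y by simp_all
  have iX: "integrable ?M ?X" by (rule integrable_const_bound[OF B X'])
  \<comment> \<open>The prediction is integrable as the solution minus an almost surely bounded
    difference; this permits splitting the mean of the difference.\<close>
  have "integrable ?M (\<lambda>\<alpha>. ?X \<alpha> - ?Y \<alpha>)"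
    by (rule integrable_const_bound[OF c]) (use X' Y' in simp)
  from Bochner_Integration.integrable_diff[OF iX this] have iY: "integrable ?M ?Y" by simp
  have "norm (expectation_on Ia \<rho> ?X - expectation_on Ia \<rho> ?Y) \<le> ?c"
    using norm_expectation_le[OF c] iX iY
    by (simp add: expectation_on_density[OF assms(2)] X Y)
  moreover have "norm (variance_on Ia \<rho> ?X - variance_on Ia \<rho> ?Y) \<le> 2 * ?c\<^sup>2 + 4 * ?c * Ct"
    using variance_perturbation[OF X' Y' B c]
    by (simp add: variance_on_density[OF assms(2)] X Y)
  ultimately show ?thesis
    by (simp add: power_mult_distrib mult_ac)
qed

end
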